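(* The $\varphi$-tensor product of any two sub-Cuntz states is also a sub-Cuntz state; that is, if $2\le n,n'<\infty$, $\omega$ is a sub-Cuntz state on $\mathcal{O}_n$ (of some order) and $\omega'$ is a sub-Cuntz state on $\mathcal{O}_{n'}$ (of some order), then $\omega\otimes_\varphi\omega'$ is a sub-Cuntz state on $\mathcal{O}_{nn'}$ (of some order).
   Context: $\mathcal{O}_n$ ($2\le n<\infty$) is the Cuntz algebra, the universal C$^*$-algebra generated by $s_1^{(n)},\ldots,s_n^{(n)}$ with $(s_i^{(n)})^*s_j^{(n)}=\delta_{ij}I$ and $\sum_{i=1}^n s_i^{(n)}(s_i^{(n)})^*=I$. For $J=(j_1,\ldots,j_k)\in\{1,\ldots,n\}^k$, $s_J^{(n)}:=s_{j_1}^{(n)}\cdots s_{j_k}^{(n)}$. For $m\ge1$ and a unit vector $z=\sum z_Je_J\in\mathcal{V}_{n,m}:=\ell^2(\{1,\ldots,n\}^m)$ (with standard orthonormal basis $\{e_J\}$), a sub-Cuntz state on $\mathcal{O}_n$ by $z$, of order $m$, is a state $\omega$ on $\mathcal{O}_n$ with $\omega(s_J^{(n)})=\overline{z_J}$ for all $J\in\{1,\ldots,n\}^m$. For $2\le n,n'<\infty$, $\varphi_{n,n'}:\mathcal{O}_{nn'}\to\mathcal{O}_n\otimes\mathcal{O}_{n'}$ is the unital $*$-embedding with $\varphi_{n,n'}(s^{(nn')}_{n'(i-1)+j})=s_i^{(n)}\otimes s_j^{(n')}$ for $i=1,\ldots,n$, $j=1,\ldots,n'$. For states $\omega_1$ on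 $\mathcal{O}_n$ and $\omega_2$ on $\mathcal{O}_{n'}$, the $\varphi$-tensor product is the state $\omega_1\otimes_\varphi\omega_2:=(\omega_1\otimes\omega_2)\circ\varphi_{n,n'}$ on $\mathcal{O}_{nn'}$. *)

theory Defs
  imports "HOL-Analysis.Analysis"
begin

text \<open>Unital C*-algebras, with the whole type as carrier. The superclass
  \<^class>\<open>real_normed_algebra_1\<close> supplies the submultiplicative norm with \<open>norm 1 = 1\<close> (so the
  zero algebra is excluded), \<^class>\<open>banach\<close> supplies completeness.\<close>

class cstar_algebra = banach + real_normed_algebra_1 +
  fixes scaleC :: "complex \<Rightarrow> 'a \<Rightarrow> 'a" (infixr "*\<^sub>C" 75)
    and star :: "'a \<Rightarrow> 'a"
  assumes scaleC_add_right: "c *\<^sub>C (x + y) = c *\<^sub>C x + c *\<^sub>C y"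
    and scaleC_add_left: "(c + d) *\<^sub>C x = c *\<^sub>C x + d *\<^sub>C x"
    and scaleC_scaleC: "c *\<^sub>C d *\<^sub>C x = (c * d) *\<^sub>C x"
    and scaleC_one: "1 *\<^sub>C x = x"
    and scaleR_scaleC: "r *\<^sub>R x = complex_of_real r *\<^sub>C x"
    and mult_scaleC_left: "(c *\<^sub>C x) * y = c *\<^sub>C (x * y)"
    and mult_scaleC_right: "x * (c *\<^sub>C y) = c *\<^sub>C (x * y)"
    and norm_scaleC: "norm (c *\<^sub>C x) = cmod c * norm x"
    and star_star: "star (star x) = x"
    and star_add: "star (x + y) = star x + star y"
    and star_scaleC: "star (c *\<^sub>C x) = cnj c *\<^sub>C star x"
    and star_mult: "star (x * y) = star y * star x"
    and cstar_identity: "norm (star x * x) = (norm x)\<^sup>2"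

instantiation complex :: cstar_algebra
begin

definition scaleC_complex :: "complex \<Rightarrow> complex \<Rightarrow> complex" where
  "scaleC_complex c x = c * x"

definition star_complex :: "complex \<Rightarrow> complex" where
  "star_complex x = cnj x"

instance
  by standard
    (auto simp: scaleC_complex_def star_complex_def algebra_simps scaleR_conv_of_real
      norm_mult power2_eq_square)

end

global_interpretation complex_vector:
  vector_space "scaleC :: complex \<Rightarrow> 'a \<Rightarrow> 'a::cstar_algebra"
  by unfold_locales (auto simp: scaleC_add_right scaleC_add_left scaleC_scaleC scaleC_one)

abbreviation clinear :: "('a::cstar_algebra \<Rightarrow> 'b::cstar_algebra) \<Rightarrow> bool" where
  "clinear \<equiv> Vector_Spaces.linear scaleC scaleC"

definition unital_star_hom :: "('a::cstar_algebra \<Rightarrow> 'b::cstar_algebra) \<Rightarrow> bool" where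
  "unital_star_hom h \<longleftrightarrow>
     clinear h \<and> h 1 = 1 \<and> (\<forall>x y. h (x * y) = h x * h y) \<and> (\<forall>x. h (star x) = star (h x))"

definition unital_star_embedding :: "('a::cstar_algebra \<Rightarrow> 'b::cstar_algebra) \<Rightarrow> bool" where
  "unital_star_embedding h \<longleftrightarrow> unital_star_hom h \<and> inj h"

definition state :: "('a::cstar_algebra \<Rightarrow> complex) \<Rightarrow> bool" where
  "state \<omega> \<longleftrightarrow>
     clinear \<omega> \<and> (\<forall>x. \<omega> (star x * x) \<in> \<real> \<and> 0 \<le> Re (\<omega> (star x * x))) \<and> \<omega> 1 = 1"

definition unital_cstar_subalgebra :: "'a::cstar_algebra set \<Rightarrow> bool" where
  "unital_cstar_subalgebra S \<longleftrightarrow>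
     complex_vector.subspace S \<and> 1 \<in> S \<and> (\<forall>x\<in>S. \<forall>y\<in>S. x * y \<in> S) \<and> (\<forall>x\<in>S. star x \<in> S) \<and>
     closed S"

text \<open>Generators are indexed by \<open>{1..n}\<close>; values of \<open>s\<close> at other indices are irrelevant.\<close>

definition cuntz_family :: "nat \<Rightarrow> (nat \<Rightarrow> 'a::cstar_algebra) \<Rightarrow> bool" where
  "cuntz_family n s \<longleftrightarrow>
     (\<forall>i\<in>{1..n}. \<forall>j\<in>{1..n}. star (s i) * s j = (if i = j then 1 else 0)) \<and>
     (\<Sum>i\<in>{1..n}. s i * star (s i)) = 1"

text \<open>The algebra \<open>'a\<close> with generators \<open>s\<close> is (a copy of) the Cuntz algebra of order \<open>n\<close>.
  HOL cannot quantify over all C*-algebras \<open>'u\<close> inside a formula, so the universal property is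
  stated relative to a target type \<open>'u\<close> passed as a parameter. The Cuntz algebra satisfies the
  predicate for every \<open>'u\<close>, so a theorem assuming it for one arbitrary \<open>'u\<close> applies to it; and no
  other algebra is let in by a poor choice of \<open>'u\<close>, since for \<open>2 \<le> n\<close> the first two clauses
  already determine \<open>'a\<close> up to isomorphism (Cuntz's uniqueness theorem).\<close>

definition cuntz_algebra ::
    "'u::cstar_algebra itself \<Rightarrow> nat \<Rightarrow> (nat \<Rightarrow> 'a::cstar_algebra) \<Rightarrow> bool" where
  "cuntz_algebra _ n s \<longleftrightarrow>
     cuntz_family n s \<and>
     (\<forall>S. unital_cstar_subalgebra S \<and> s ` {1..n} \<subseteq> S \<longrightarrow> S = UNIV) \<and>
     (\<forall>t :: nat \<Rightarrow> 'u. cuntz_family n t \<longrightarrow>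
        (\<exists>!h. unital_star_hom h \<and> (\<forall>i\<in>{1..n}. h (s i) = t i)))"

text \<open>The type \<open>'t\<close> with elementary tensors \<open>tens a b\<close> is a C*-completion of the algebraic tensor
  product of \<open>'a\<close> and \<open>'b\<close>; the injectivity of the algebraic tensor product into \<open>'t\<close> is the
  clause on independent \<open>X\<close>. The C*-norm is not specified further: Cuntz algebras are nuclear, so
  on their algebraic tensor product there is only one.\<close>

definition cstar_tensor_product ::
    "('a::cstar_algebra \<Rightarrow> 'b::cstar_algebra \<Rightarrow> 't::cstar_algebra) \<Rightarrow> bool" where
  "cstar_tensor_product tens \<longleftrightarrow>
     (\<forall>b. clinear (\<lambda>a. tens a b)) \<and>
     (\<forall>a. clinear (\<lambda>b. tens a b)) \<and>
     tens 1 1 = 1 \<and>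
     (\<forall>a b c d. tens a b * tens c d = tens (a * c) (b * d)) \<and>
     (\<forall>a b. star (tens a b) = tens (star a) (star b)) \<and>
     (\<forall>X f. finite X \<and> complex_vector.independent X \<and> (\<Sum>x\<in>X. tens x (f x)) = 0
        \<longrightarrow> (\<forall>x\<in>X. f x = 0)) \<and>
     closure (complex_vector.span {tens a b | a b. True}) = UNIV"

definition words :: "nat \<Rightarrow> nat \<Rightarrow> nat list set" where
  "words n m = {J. set J \<subseteq> {1..n} \<and> length J = m}"

definition word_prod :: "(nat \<Rightarrow> 'a::cstar_algebra) \<Rightarrow> nat list \<Rightarrow> 'a" where
  "word_prod s J = prod_list (map s J)"

text \<open>A vector of \<open>\<ell>\<^sup>2({1..n}\<^sup>m)\<close> is given by its coordinates \<open>z J\<close> for \<open>J \<in> words n m\<close>.\<close>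

definition sub_cuntz_state_by ::
    "nat \<Rightarrow> (nat \<Rightarrow> 'a::cstar_algebra) \<Rightarrow> nat \<Rightarrow> (nat list \<Rightarrow> complex) \<Rightarrow> ('a \<Rightarrow> complex) \<Rightarrow> bool"
  where
  "sub_cuntz_state_by n s m z \<omega> \<longleftrightarrow>
     1 \<le> m \<and> L2_set (\<lambda>J. cmod (z J)) (words n m) = 1 \<and>
     state \<omega> \<and> (\<forall>J\<in>words n m. \<omega> (word_prod s J) = cnj (z J))"

definition sub_cuntz_state ::
    "nat \<Rightarrow> (nat \<Rightarrow> 'a::cstar_algebra) \<Rightarrow> ('a \<Rightarrow> complex) \<Rightarrow> bool" where
  "sub_cuntz_state n s \<omega> \<longleftrightarrow> (\<exists>m z. sub_cuntz_state_by n s m z \<omega>)"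

text \<open>\<open>\<phi>\<close> maps the Cuntz algebra generated by \<open>u\<close>, of order \<open>n * n'\<close>; every index in
  \<open>{1..n * n'}\<close> is \<open>n' * (i - 1) + j\<close> for exactly one pair, so \<open>\<phi>\<close> is unique.\<close>

definition cuntz_tensor_embedding ::
    "nat \<Rightarrow> nat \<Rightarrow> (nat \<Rightarrow> 'a::cstar_algebra) \<Rightarrow> (nat \<Rightarrow> 'b::cstar_algebra) \<Rightarrow>
     (nat \<Rightarrow> 'c::cstar_algebra) \<Rightarrow> ('a \<Rightarrow> 'b \<Rightarrow> 't::cstar_algebra) \<Rightarrow> ('c \<Rightarrow> 't) \<Rightarrow> bool" where
  "cuntz_tensor_embedding n n' s s' u tens \<phi> \<longleftrightarrow>
     unital_star_embedding \<phi> \<and>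
     (\<forall>i\<in>{1..n}. \<forall>j\<in>{1..n'}. \<phi> (u (n' * (i - 1) + j)) = tens (s i) (s' j))"

text \<open>\<open>\<Omega>\<close> is the product state of \<open>\<omega>\<close> and \<open>\<omega>'\<close>; it is determined by its values on elementary
  tensors, because states are continuous and elementary tensors span a dense subspace.\<close>

definition product_state ::
    "('a::cstar_algebra \<Rightarrow> 'b::cstar_algebra \<Rightarrow> 't::cstar_algebra) \<Rightarrow>
     ('a \<Rightarrow> complex) \<Rightarrow> ('b \<Rightarrow> complex) \<Rightarrow> ('t \<Rightarrow> complex) \<Rightarrow> bool" where
  "product_state tens \<omega> \<omega>' \<Omega> \<longleftrightarrow> state \<Omega> \<and> (\<forall>a b. \<Omega> (tens a b) = \<omega> a * \<omega>' b)"

end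

theory Submission
  imports Defs
begin

text \<open>
  The point is that a sub-Cuntz state of order \<open>m\<close> is automatically a sub-Cuntz state of every
  order \<open>k * m\<close> with \<open>k \<ge> 1\<close>; two sub-Cuntz states, of orders \<open>m\<close> and \<open>m'\<close>, can thus be compared
  at the common order \<open>m' * m\<close>, and there the tensor product is immediate: a word of length \<open>l\<close> in
  the generators of the algebra of order \<open>n * n'\<close> is sent by the embedding to the elementary tensor
  of two words of the same length \<open>l\<close>, so the values of the product state on words are the
  coordinates of the conjugate of a tensor product of two unit vectors, again a unit vector.

  To raise the order, let \<open>\<omega>\<close> be sub-Cuntz by the unit vector \<open>z\<close> and put
  \<open>v = (\<Sum>J. z J *\<^sub>C s\<^sub>J)\<close>. The words of length \<open>m\<close> are isometries with mutually orthogonal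
  ranges, so \<open>v\<close> is an isometry with \<open>\<omega> v = 1\<close>. This is the equality case of the Cauchy-Schwarz
  inequality: \<open>v - 1\<close> is in the left kernel of \<open>\<omega>\<close>, that is, \<open>v\<close> fixes the cyclic vector of the
  GNS representation. Hence \<open>\<omega> (v\<^sup>* x) = \<omega> x\<close> for all \<open>x\<close>, and since \<open>v\<^sup>* s\<^sub>J = cnj (z J) 1\<close>, the
  state is multiplicative in its first \<open>m\<close> letters: \<open>\<omega> (s\<^sub>J x) = \<omega> s\<^sub>J \<omega> x\<close>
  (\<open>sub_cuntz_state_by_word_mult\<close>). So the vector of values on words of length \<open>m + l\<close> is the
  tensor product of those for the lengths \<open>m\<close> and \<open>l\<close>, and norms multiply.
\<close>

section \<open>Involution and linear maps\<close>

lemma star_one [simp]: "star (1::'a::cstar_algebra) = 1"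
proof -
  have "star (star (1::'a) * 1) = star 1 * star (star 1)"
    by (rule star_mult)
  then show ?thesis
    by (simp add: star_star)
qed

lemma star_zero [simp]: "star (0::'a::cstar_algebra) = 0"
proof -
  have "star (0 + 0 :: 'a) = star 0 + star 0"
    by (rule star_add)
  then show ?thesis
    by simp
qed

lemma star_sum: "star (\<Sum>i\<in>A. f i) = (\<Sum>i\<in>A. star (f i :: 'a::cstar_algebra))"
  by (induction A rule: infinite_finite_induct) (simp_all add: star_add)

lemma star_minus_one: "star (v - 1) = star (v::'a::cstar_algebra) - 1"
proof -
  have "star ((v - 1) + 1) = star (v - 1) + star 1"
    by (rule star_add)
  then show ?thesis
    by (simp add: algebra_simps)
qed

lemma clinear_add: "clinear f \<Longrightarrow> f (x + y) = f x + f y"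
  by (simp add: Vector_Spaces.linear_iff)

lemma clinear_scaleC: "clinear f \<Longrightarrow> f (c *\<^sub>C x) = c *\<^sub>C f x"
  by (simp add: Vector_Spaces.linear_iff)

lemma clinear_diff: "clinear f \<Longrightarrow> f (x - y) = f x - f y"
  using clinear_add[of f "x - y" y] by (simp add: algebra_simps)

lemma clinear_sum:
  assumes "clinear f"
  shows "f (\<Sum>i\<in>A. g i) = (\<Sum>i\<in>A. f (g i))"
proof -
  have "f 0 = 0"
    using clinear_diff[OF assms, of 0 0] by simp
  then show ?thesis
    by (induction A rule: infinite_finite_induct) (simp_all add: clinear_add[OF assms])
qed

section \<open>States\<close>

lemma state_clinear: "state \<omega> \<Longrightarrow> clinear \<omega>"
  by (simp add: state_def)

lemma state_square_real: "state \<omega> \<Longrightarrow> Im (\<omega> (star x * x)) = 0"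
  by (auto simp: state_def complex_is_Real_iff)

lemma state_square_nonneg: "state \<omega> \<Longrightarrow> 0 \<le> Re (\<omega> (star x * x))"
  by (simp add: state_def)

lemma state_square_expand:
  assumes "state \<omega>"
  shows "\<omega> (star (x + t *\<^sub>C y) * (x + t *\<^sub>C y)) =
    \<omega> (star x * x) + t * \<omega> (star x * y) + cnj t * \<omega> (star y * x) + (cnj t * t) * \<omega> (star y * y)"
proof -
  have "star (x + t *\<^sub>C y) * (x + t *\<^sub>C y) =
    star x * x + t *\<^sub>C (star x * y) + cnj t *\<^sub>C (star y * x) + (cnj t * t) *\<^sub>C (star y * y)"
    by (simp add: star_add star_scaleC distrib_left distrib_right mult_scaleC_left
        mult_scaleC_right scaleC_scaleC scaleC_add_right mult.commute add_ac)
  then show ?thesis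
    by (simp add: clinear_add[OF state_clinear[OF assms]] clinear_scaleC[OF state_clinear[OF assms]]
        scaleC_complex_def)
qed

text \<open>Positivity makes \<open>\<omega> (star y * y)\<close> real, and polarization along \<open>y = 1 + t x\<close> with
  \<open>t = 1\<close> and \<open>t = \<i>\<close> turns this into the two real equations of the claim.\<close>

lemma state_star:
  assumes "state \<omega>"
  shows "\<omega> (star x) = cnj (\<omega> x)"
proof -
  have "Im (\<omega> (star (1 + t *\<^sub>C x) * (1 + t *\<^sub>C x))) = 0" for t
    by (rule state_square_real[OF assms])
  then have real: "Im (\<omega> (star 1 * 1) + t * \<omega> (star 1 * x) + cnj t * \<omega> (star x * 1) +
      (cnj t * t) * \<omega> (star x * x)) = 0" for t
    by (simp only: state_square_expand[OF assms])
  show ?thesis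
    using real[of 1] real[of \<i>] state_square_real[OF assms, of 1] state_square_real[OF assms, of x]
    by (simp add: complex_eq_iff)
qed

text \<open>The degenerate case of the Cauchy-Schwarz inequality: in the null direction \<open>y\<close> the
  quadratic form has no second-order term, so along every real line it is affine and bounded below,
  hence constant. A suitable multiple of \<open>y\<close> as direction makes the slope \<open>2 \<bar>\<omega> (star y * x)\<bar>\<^sup>2\<close>.\<close>

lemma state_null_left:
  assumes \<omega>: "state \<omega>" and null: "\<omega> (star y * y) = 0"
  shows "\<omega> (star y * x) = 0"
proof -
  have herm: "\<omega> (star x * y) = cnj (\<omega> (star y * x))"
    using state_star[OF \<omega>, of "star y * x"] by (simp add: star_mult star_star)
  define b where "b = \<omega> (star y * x)"
  define c where "c = Re (\<omega> (star x * x))"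
  have bound: "0 \<le> c + 2 * r * (cmod b)\<^sup>2" for r :: real
  proof -
    have "Re (\<omega> (star (x + (of_real r * b) *\<^sub>C y) * (x + (of_real r * b) *\<^sub>C y))) =
        c + 2 * r * (cmod b)\<^sup>2"
      unfolding state_square_expand[OF \<omega>] null herm b_def[symmetric]
      by (simp add: c_def cmod_power2) (simp add: power2_eq_square algebra_simps)
    then show ?thesis
      using state_square_nonneg[OF \<omega>, of "x + (of_real r * b) *\<^sub>C y"] by simp
  qed
  have "b = 0"
  proof (rule ccontr)
    assume "b \<noteq> 0"
    then show False
      \<comment> \<open>At this parameter the affine function takes the value \<open>-1\<close>.\<close>
      using bound[of "- (c + 1) / (2 * (cmod b)\<^sup>2)"] by (simp add: field_simps)
  qed
  then show ?thesis
    by (simp add: b_def)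
qed

text \<open>In GNS terms, a unit vector \<open>\<xi>\<close> is fixed by any isometry \<open>v\<close> for which \<open>v \<xi>\<close> has inner
  product \<open>1\<close> with \<open>\<xi>\<close>, and \<open>\<omega> (star v * x)\<close> is the inner product of \<open>v \<xi>\<close> with \<open>x \<xi>\<close>.\<close>

lemma state_absorbs_isometry:
  assumes \<omega>: "state \<omega>" and isometry: "star v * v = 1" and one: "\<omega> v = 1"
  shows "\<omega> (star v * x) = \<omega> x"
proof -
  note lin = clinear_diff[OF state_clinear[OF \<omega>]]
  have "star (v - 1) * (v - 1) = 1 - star v - (v - 1)"
    by (simp add: star_minus_one isometry algebra_simps)
  then have "\<omega> (star (v - 1) * (v - 1)) = 0"
    using \<omega> by (simp add: lin state_star one state_def)
  then have "\<omega> (star (v - 1) * x) = 0"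
    by (rule state_null_left[OF \<omega>])
  then show ?thesis
    by (simp add: star_minus_one left_diff_distrib lin)
qed

lemma state_comp_unital_star_hom:
  assumes \<omega>: "state \<omega>" and h: "unital_star_hom h"
  shows "state (\<omega> \<circ> h)"
proof -
  have "clinear (\<omega> \<circ> h)"
    using h state_clinear[OF \<omega>] by (auto simp: unital_star_hom_def intro: Vector_Spaces.linear_compose)
  moreover have "h (star x * x) = star (h x) * h x" for x
    using h by (simp add: unital_star_hom_def)
  ultimately show ?thesis
    using assms by (simp add: state_def unital_star_hom_def)
qed

section \<open>Sums over words\<close>

lemma words_0 [simp]: "words n 0 = {[]}"
  by (auto simp: words_def)

lemma finite_words: "finite (words n m)"
  by (auto simp: words_def finite_lists_length_eq)

lemma words_Suc: "words n (Suc m) = (\<lambda>(i, J). i # J) ` ({1..n} \<times> words n m)"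
proof (rule set_eqI)
  fix K
  show "K \<in> words n (Suc m) \<longleftrightarrow> K \<in> (\<lambda>(i, J). i # J) ` ({1..n} \<times> words n m)"
    by (cases K) (auto simp: words_def image_iff)
qed

lemma sum_words_Suc: "(\<Sum>J\<in>words n (Suc m). f J) = (\<Sum>i\<in>{1..n}. \<Sum>J\<in>words n m. f (i # J))"
proof -
  have "inj_on (\<lambda>(i, J). i # J) ({1..n} \<times> words n m)"
    by (auto simp: inj_on_def)
  then show ?thesis
    by (simp add: words_Suc sum.reindex sum.cartesian_product case_prod_unfold)
qed

lemma sum_words_add:
  "(\<Sum>K\<in>words n (m + l). f K) = (\<Sum>I\<in>words n m. \<Sum>J\<in>words n l. f (I @ J))"
  by (induction m arbitrary: f) (simp_all add: sum_words_Suc)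

lemma sum_product_index:
  fixes f :: "nat \<Rightarrow> 'x::comm_monoid_add"
  shows "(\<Sum>k\<in>{1..n * n'}. f k) = (\<Sum>i\<in>{1..n}. \<Sum>j\<in>{1..n'}. f (n' * (i - 1) + j))"
proof (induction n)
  case (Suc n)
  have "(\<Sum>k\<in>{1..Suc n * n'}. f k) = (\<Sum>k\<in>{1..n * n'}. f k) + (\<Sum>k\<in>{n * n' + 1..n * n' + n'}. f k)"
    using sum.ub_add_nat[of 1 "n * n'" f n'] by (simp add: add.commute)
  also have "(\<Sum>k\<in>{n * n' + 1..n * n' + n'}. f k) = (\<Sum>j\<in>{1..n'}. f (n' * n + j))"
    using sum.shift_bounds_cl_nat_ivl[of f 1 "n * n'" n'] by (simp add: ac_simps)
  finally show ?case
    using Suc.IH by simp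
qed simp

lemma sum_words_product:
  fixes f :: "nat list \<Rightarrow> 'x::comm_monoid_add"
  shows "(\<Sum>K\<in>words (n * n') l. f K) =
    (\<Sum>I\<in>words n l. \<Sum>J\<in>words n' l. f (map2 (\<lambda>i j. n' * (i - 1) + j) I J))"
proof (induction l arbitrary: f)
  case (Suc l)
  let ?g = "\<lambda>i j. n' * (i - 1) + j"
  have "(\<Sum>K\<in>words (n * n') (Suc l). f K) =
    (\<Sum>i\<in>{1..n}. \<Sum>j\<in>{1..n'}. \<Sum>I\<in>words n l. \<Sum>J\<in>words n' l. f (?g i j # map2 ?g I J))"
    by (simp only: sum_words_Suc sum_product_index Suc.IH)
  also have "\<dots> =
    (\<Sum>i\<in>{1..n}. \<Sum>I\<in>words n l. \<Sum>j\<in>{1..n'}. \<Sum>J\<in>words n' l. f (?g i j # map2 ?g I J))"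
    by (intro sum.cong refl sum.swap)
  finally show ?case
    by (simp add: sum_words_Suc)
qed simp

section \<open>Words in a Cuntz family\<close>

lemma word_prod_Nil [simp]: "word_prod s [] = 1"
  by (simp add: word_prod_def)

lemma word_prod_Cons [simp]: "word_prod s (i # J) = s i * word_prod s J"
  by (simp add: word_prod_def)

lemma word_prod_append: "word_prod s (I @ J) = word_prod s I * word_prod s J"
  by (simp add: word_prod_def)

lemma word_prod_orthonormal:
  assumes s: "cuntz_family n s"
  shows "J \<in> words n m \<Longrightarrow> K \<in> words n m \<Longrightarrow>
    star (word_prod s J) * word_prod s K = (if J = K then 1 else 0)"
proof (induction m arbitrary: J K)
  case (Suc m)
  obtain i I where J: "J = i # I" "i \<in> {1..n}" "I \<in> words n m"
    using Suc.prems(1) by (auto simp: words_Suc)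
  obtain k L where K: "K = k # L" "k \<in> {1..n}" "L \<in> words n m"
    using Suc.prems(2) by (auto simp: words_Suc)
  have "star (word_prod s J) * word_prod s K = star (word_prod s I) * (star (s i) * s k) * word_prod s L"
    by (simp add: J(1) K(1) star_mult mult.assoc)
  also have "star (s i) * s k = (if i = k then 1 else 0)"
    using s J(2) K(2) by (simp add: cuntz_family_def)
  finally show ?case
    using Suc.IH[OF J(3) K(3)] by (auto simp: J(1) K(1))
qed simp

text \<open>The words of a fixed length span a Hilbert space inside the algebra, whose inner product is
  \<open>star v * w\<close> and for which they are an orthonormal basis. The next lemma reads off the
  coordinates of a vector in this basis.\<close>

lemma word_combination_coordinate:
  fixes s :: "nat \<Rightarrow> 'a::cstar_algebra"
  assumes "cuntz_family n s" and "K \<in> words n m"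
  shows "star (\<Sum>J\<in>words n m. z J *\<^sub>C word_prod s J) * word_prod s K = cnj (z K) *\<^sub>C 1"
proof -
  have "star (\<Sum>J\<in>words n m. z J *\<^sub>C word_prod s J) * word_prod s K =
      (\<Sum>J\<in>words n m. cnj (z J) *\<^sub>C (star (word_prod s J) * word_prod s K))"
    by (simp add: star_sum star_scaleC sum_distrib_right mult_scaleC_left)
  also have "\<dots> = (\<Sum>J\<in>words n m. if J = K then cnj (z K) *\<^sub>C 1 else 0)"
    by (intro sum.cong) (simp_all add: word_prod_orthonormal[OF assms(1) _ assms(2)])
  finally show ?thesis
    using assms(2) by (simp add: finite_words)
qed

lemma word_combination_isometry:
  fixes s :: "nat \<Rightarrow> 'a::cstar_algebra"
  assumes "cuntz_family n s" and unit: "(\<Sum>J\<in>words n m. (cmod (z J))\<^sup>2) = 1"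
    and v: "v = (\<Sum>J\<in>words n m. z J *\<^sub>C word_prod s J)"
  shows "star v * v = 1"
proof -
  have "star v * v = (\<Sum>K\<in>words n m. z K *\<^sub>C (star v * word_prod s K))"
    by (subst (2) v) (simp add: sum_distrib_left mult_scaleC_right)
  also have "\<dots> = (\<Sum>K\<in>words n m. complex_of_real ((cmod (z K))\<^sup>2) *\<^sub>C 1)"
    by (intro sum.cong refl)
      (simp add: v word_combination_coordinate[OF assms(1)] scaleC_scaleC complex_norm_square
        del: of_real_power)
  also have "\<dots> = (\<Sum>K\<in>words n m. complex_of_real ((cmod (z K))\<^sup>2)) *\<^sub>C 1"
    by (simp add: complex_vector.scale_sum_left)
  also have "\<dots> = 1"
    by (simp only: of_real_sum[symmetric] unit) (simp add: scaleC_one)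
  finally show ?thesis .
qed

section \<open>Raising the order of a sub-Cuntz state\<close>

text \<open>For a state, the vector \<open>z\<close> of a given order is forced, so being sub-Cuntz of that order is a
  condition of unit length on the values on words. The sum of squares is easier to multiply than the
  norm.\<close>

lemma sub_cuntz_state_by_values_iff:
  "(\<exists>z. sub_cuntz_state_by n s m z \<omega>) \<longleftrightarrow>
    1 \<le> m \<and> state \<omega> \<and> (\<Sum>J\<in>words n m. (cmod (\<omega> (word_prod s J)))\<^sup>2) = 1"
    (is "?L \<longleftrightarrow> ?R")
proof
  assume ?L
  then show ?R
    by (auto simp: sub_cuntz_state_by_def L2_set_def)
next
  assume ?R
  then have "sub_cuntz_state_by n s m (\<lambda>J. cnj (\<omega> (word_prod s J))) \<omega>"
    by (simp add: sub_cuntz_state_by_def L2_set_def)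
  then show ?L
    by blast
qed

lemma sub_cuntz_state_by_word_mult:
  assumes s: "cuntz_family n s" and \<omega>: "sub_cuntz_state_by n s m z \<omega>" and J: "J \<in> words n m"
  shows "\<omega> (word_prod s J * x) = \<omega> (word_prod s J) * \<omega> x"
proof -
  have st: "state \<omega>" and val: "\<And>J. J \<in> words n m \<Longrightarrow> \<omega> (word_prod s J) = cnj (z J)"
    and unit: "(\<Sum>J\<in>words n m. (cmod (z J))\<^sup>2) = 1"
    using \<omega> by (auto simp: sub_cuntz_state_by_def L2_set_def)
  define v where "v = (\<Sum>J\<in>words n m. z J *\<^sub>C word_prod s J)"
  have isometry: "star v * v = 1"
    by (rule word_combination_isometry[OF s unit v_def])
  have "\<omega> v = (\<Sum>J\<in>words n m. z J * cnj (z J))"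
    unfolding v_def
    by (simp add: clinear_sum[OF state_clinear[OF st]] clinear_scaleC[OF state_clinear[OF st]]
        scaleC_complex_def val)
  also have "\<dots> = complex_of_real (\<Sum>J\<in>words n m. (cmod (z J))\<^sup>2)"
    by (simp only: of_real_sum complex_norm_square)
  finally have one: "\<omega> v = 1"
    by (simp add: unit)
  have "\<omega> (word_prod s J * x) = \<omega> (star v * (word_prod s J * x))"
    by (rule state_absorbs_isometry[OF st isometry one, symmetric])
  also have "star v * (word_prod s J * x) = cnj (z J) *\<^sub>C x"
    by (simp add: v_def mult.assoc[symmetric] word_combination_coordinate[OF s J] mult_scaleC_left)
  finally show ?thesis
    by (simp add: clinear_scaleC[OF state_clinear[OF st]] scaleC_complex_def val[OF J])
qed

lemma sub_cuntz_state_by_add_order: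
  assumes s: "cuntz_family n s" and z: "sub_cuntz_state_by n s m z \<omega>"
    and y: "sub_cuntz_state_by n s l y \<omega>"
  shows "\<exists>w. sub_cuntz_state_by n s (m + l) w \<omega>"
proof -
  let ?q = "\<lambda>J. (cmod (\<omega> (word_prod s J)))\<^sup>2"
  have m: "1 \<le> m" "state \<omega>" "sum ?q (words n m) = 1"
    using z sub_cuntz_state_by_values_iff[of n s m \<omega>] by blast+
  have l: "sum ?q (words n l) = 1"
    using y sub_cuntz_state_by_values_iff[of n s l \<omega>] by blast
  have "sum ?q (words n (m + l)) = (\<Sum>I\<in>words n m. \<Sum>J\<in>words n l. ?q I * ?q J)"
    unfolding sum_words_add
    by (intro sum.cong refl)
      (simp add: word_prod_append sub_cuntz_state_by_word_mult[OF s z] norm_mult power_mult_distrib)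
  also have "\<dots> = 1"
    by (simp only: sum_product[symmetric] m l mult_1)
  finally show ?thesis
    using m by (simp add: sub_cuntz_state_by_values_iff)
qed

lemma sub_cuntz_state_by_mult_order:
  assumes "cuntz_family n s" and "sub_cuntz_state_by n s m z \<omega>" and "1 \<le> k"
  shows "\<exists>w. sub_cuntz_state_by n s (k * m) w \<omega>"
  using assms(3)
proof (induction k rule: dec_induct)
  case base
  then show ?case
    using assms(2) by auto
next
  case (step k)
  then show ?case
    using sub_cuntz_state_by_add_order[OF assms(1,2)] by auto
qed

section \<open>The tensor product\<close>

lemma cuntz_tensor_embedding_word_prod:
  assumes t: "cstar_tensor_product tens" and \<phi>: "cuntz_tensor_embedding n n' s s' u tens \<phi>"
  shows "I \<in> words n l \<Longrightarrow> J \<in> words n' l \<Longrightarrow>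
    \<phi> (word_prod u (map2 (\<lambda>i j. n' * (i - 1) + j) I J)) = tens (word_prod s I) (word_prod s' J)"
proof (induction l arbitrary: I J)
  case 0
  then show ?case
    using t \<phi>
    by (simp add: cstar_tensor_product_def cuntz_tensor_embedding_def unital_star_embedding_def
        unital_star_hom_def)
next
  case (Suc l)
  obtain i I' where I: "I = i # I'" "i \<in> {1..n}" "I' \<in> words n l"
    using Suc.prems(1) by (auto simp: words_Suc)
  obtain j J' where J: "J = j # J'" "j \<in> {1..n'}" "J' \<in> words n' l"
    using Suc.prems(2) by (auto simp: words_Suc)
  have mult: "\<phi> (x * y) = \<phi> x * \<phi> y" for x y
    using \<phi> by (simp add: cuntz_tensor_embedding_def unital_star_embedding_def unital_star_hom_def)
  have gen: "\<phi> (u (n' * (i - 1) + j)) = tens (s i) (s' j)"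
    using \<phi> I(2) J(2) by (simp add: cuntz_tensor_embedding_def)
  have tens_mult: "tens a b * tens c d = tens (a * c) (b * d)" for a b c d
    using t by (simp add: cstar_tensor_product_def)
  show ?case
    using gen Suc.IH[OF I(3) J(3)] by (simp add: I(1) J(1) mult tens_mult)
qed

theorem proposition1p11:
  fixes n n' :: nat
    and s :: "nat \<Rightarrow> 'a::cstar_algebra"
    and s' :: "nat \<Rightarrow> 'b::cstar_algebra"
    and u :: "nat \<Rightarrow> 'c::cstar_algebra"
    and tens :: "'a \<Rightarrow> 'b \<Rightarrow> 't::cstar_algebra"
    and \<phi> :: "'c \<Rightarrow> 't"
    and \<omega> :: "'a \<Rightarrow> complex"
    and \<omega>' :: "'b \<Rightarrow> complex"
    and \<Omega> :: "'t \<Rightarrow> complex"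
  assumes "2 \<le> n" and "2 \<le> n'"
    and "cuntz_algebra TYPE('u::cstar_algebra) n s"
    and "cuntz_algebra TYPE('u) n' s'"
    and "cuntz_algebra TYPE('u) (n * n') u"
    and "cstar_tensor_product tens"
    and "cuntz_tensor_embedding n n' s s' u tens \<phi>"
    and "sub_cuntz_state n s \<omega>"
    and "sub_cuntz_state n' s' \<omega>'"
    and "product_state tens \<omega> \<omega>' \<Omega>"
  shows "sub_cuntz_state (n * n') u (\<Omega> \<circ> \<phi>)"
proof -
  have s: "cuntz_family n s" and s': "cuntz_family n' s'"
    using assms(3,4) by (simp_all add: cuntz_algebra_def)
  obtain m z where z: "sub_cuntz_state_by n s m z \<omega>"
    using assms(8) by (auto simp: sub_cuntz_state_def)
  obtain m' z' where z': "sub_cuntz_state_by n' s' m' z' \<omega>'"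
    using assms(9) by (auto simp: sub_cuntz_state_def)
  have pos: "1 \<le> m" "1 \<le> m'"
    using z z' by (simp_all add: sub_cuntz_state_by_def)
  define l where "l = m' * m"
  have l: "1 \<le> l"
    using pos by (simp add: l_def)
  let ?q = "\<lambda>I. (cmod (\<omega> (word_prod s I)))\<^sup>2"
  let ?q' = "\<lambda>J. (cmod (\<omega>' (word_prod s' J)))\<^sup>2"
  have q: "sum ?q (words n l) = 1"
    using sub_cuntz_state_by_mult_order[OF s z pos(2)]
    by (simp add: sub_cuntz_state_by_values_iff l_def)
  have q': "sum ?q' (words n' l) = 1"
    using sub_cuntz_state_by_mult_order[OF s' z' pos(1)]
    by (simp add: sub_cuntz_state_by_values_iff l_def mult.commute)
  have "state \<Omega>" and \<Omega>: "\<And>a b. \<Omega> (tens a b) = \<omega> a * \<omega>' b"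
    using assms(10) by (simp_all add: product_state_def)
  then have st: "state (\<Omega> \<circ> \<phi>)"
    using assms(7) state_comp_unital_star_hom
    by (auto simp: cuntz_tensor_embedding_def unital_star_embedding_def)
  have "(\<Sum>K\<in>words (n * n') l. (cmod ((\<Omega> \<circ> \<phi>) (word_prod u K)))\<^sup>2) =
      (\<Sum>I\<in>words n l. \<Sum>J\<in>words n' l. ?q I * ?q' J)"
    unfolding sum_words_product
    by (intro sum.cong refl)
      (simp only: o_apply cuntz_tensor_embedding_word_prod[OF assms(6,7)] \<Omega> norm_mult
        power_mult_distrib)
  also have "\<dots> = 1"
    by (simp only: sum_product[symmetric] q q' mult_1)
  finally have "\<exists>w. sub_cuntz_state_by (n * n') u l w (\<Omega> \<circ> \<phi>)"
    using l st by (simp add: sub_cuntz_state_by_values_iff)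
  then show ?thesis
    by (auto simp: sub_cuntz_state_def)
qed

end
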